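(* Let $\varepsilon(x,\xi)\ge 0$ and $\rho(x,\xi)$ belong to $C^1(\mathbb{S}D)$, let $f(t,x,\xi)\in C^1(\mathbb{R}\times\mathbb{S}D)$, and put $\alpha=\varepsilon+\mathrm{i}\rho$. Let $u_k(t,x,\xi)$, $k\ge 0$ an integer, be the non-stationary attenuated ray transform of order $k$ of $f$. Then on $\mathbb{R}\times\mathbb{S}D$ $$\Big(\frac{\partial}{\partial t}+\mathcal{H}+\alpha\Big)u_k=k\,u_{k-1},\qquad k\ge 1,$$ $$\Big(\frac{\partial}{\partial t}+\mathcal{H}+\alpha\Big)u_0=f .$$ In particular, if $f(t,x,\xi)=\langle w(t,x),\xi^m\rangle$ for a symmetric $m$-tensor field $w(t,x)$ of class $C^1$ on $\mathbb{R}\times D$, then $$\Big(\frac{\partial}{\partial t}+\mathcal{H}+\alpha\Big)u_0=\langle w,\xi^m\rangle .$$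
   Context: $D\subset\mathbb{R}^3$ is a bounded convex domain with smooth boundary, $\mathbb{S}^2$ is the unit sphere of $\mathbb{R}^3$, and $\mathbb{S}D=\{(x,\xi): x\in D,\ \xi\in\mathbb{S}^2\}$. The functions $\varepsilon,\rho$ are real-valued. The functions $\varepsilon,\rho,f$ (and the field $w$) are bounded and finite with respect to $x$, i.e. they vanish for $x$ outside some compact subset of $D$; they are extended by zero to all $x\in\mathbb{R}^3$. The non-stationary attenuated ray transform (ART) of order $k$ of $f$ is $$u_k(t,x,\xi)=\int_0^\infty s^k\exp\Big(-\int_0^s\alpha(x-\sigma\xi,\xi)\,d\sigma\Big) f(t-s,x-s\xi,\xi)\,ds .$$ The operator $\mathcal{H}$ is $(\mathcal{H}\psi)(t,x,\xi)=\frac{d}{d\tau}\psi(t,x+\tau\xi,\xi)\big|_{\tau=0}=\sum_{j=1}^3\xi^j\frac{\partial\psi}{\partial x^j}(t,x,\xi)$, and $\alpha$ acts by multiplication. A symmetric $m$-tensor field $w$ ($m\ge 0$ an integer) has components $w_{i_1\ldots i_m}(t,x)$, $i_1,\dots,i_m\in\{1,2,3\}$, symmetric in the indices, and $\langle w(t,x),\xi^m\rangle=\sum_{i_1,\dots,i_m=1}^3 w_{i_1\ldots i_m}(t,x)\xi^{i_1}\cdots\xi^{i_m}$. *)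

theory Defs
  imports "HOL-Analysis.Analysis" "HOL-Library.Multiset"
begin

type_synonym vec3 = "real ^ 3"

section \<open>Differentiability classes\<close>

fun Ck_on :: "nat \<Rightarrow> 'a::euclidean_space set \<Rightarrow> ('a \<Rightarrow> 'b::real_normed_vector) \<Rightarrow> bool" where
  "Ck_on 0 U g \<longleftrightarrow> continuous_on U g"
| "Ck_on (Suc n) U g \<longleftrightarrow>
     (\<forall>x\<in>U. g differentiable (at x)) \<and>
     (\<forall>v. Ck_on n U (\<lambda>x. frechet_derivative g (at x) v))"

text \<open>
  The class C1 on a set that need not be open, by local C1 extensions to open sets of the ambient
  space. For an embedded submanifold, such as \<open>D \<times> S\<close> with \<open>D\<close> open and \<open>S\<close> the unit sphere,
  this is the C1 class of the manifold.
\<close>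

definition C1_on :: "'a::euclidean_space set \<Rightarrow> ('a \<Rightarrow> 'b::real_normed_vector) \<Rightarrow> bool" where
  "C1_on S f \<longleftrightarrow>
     (\<forall>p\<in>S. \<exists>U g. open U \<and> p \<in> U \<and> Ck_on 1 U g \<and> (\<forall>x\<in>U \<inter> S. g x = f x))"

section \<open>The domain\<close>

definition smooth_boundary :: "vec3 set \<Rightarrow> bool" where
  "smooth_boundary D \<longleftrightarrow>
     (\<forall>p\<in>frontier D. \<exists>U (g :: vec3 \<Rightarrow> real).
        open U \<and> p \<in> U \<and> (\<forall>n. Ck_on n U g) \<and>
        (\<exists>v. frechet_derivative g (at p) v \<noteq> 0) \<and>
        D \<inter> U = {x \<in> U. g x < 0} \<and> frontier D \<inter> U = {x \<in> U. g x = 0})"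

definition bounded_convex_domain :: "vec3 set \<Rightarrow> bool" where
  "bounded_convex_domain D \<longleftrightarrow>
     D \<noteq> {} \<and> open D \<and> bounded D \<and> convex D \<and> smooth_boundary D"

abbreviation S2 :: "vec3 set" where
  "S2 \<equiv> sphere 0 1"

section \<open>Admissible data\<close>

text \<open>
  All functions of \<open>x\<close> live on the whole space. Finiteness with respect to \<open>x\<close> demands that
  they vanish off a compact subset of \<open>D\<close>, the same one for all \<open>t\<close> and \<open>\<xi>\<close>; hence they
  coincide with their extension by zero from \<open>D\<close>. Values at \<open>\<xi>\<close> outside the sphere are
  unconstrained and irrelevant.
\<close>

definition compactly_inside :: "vec3 set \<Rightarrow> vec3 set \<Rightarrow> bool" where
  "compactly_inside D A \<longleftrightarrow> (\<exists>K. compact K \<and> K \<subseteq> D \<and> A \<subseteq> K)"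

definition coefficient :: "vec3 set \<Rightarrow> (vec3 \<Rightarrow> vec3 \<Rightarrow> real) \<Rightarrow> bool" where
  "coefficient D a \<longleftrightarrow>
     C1_on (D \<times> S2) (\<lambda>(x, \<xi>). a x \<xi>) \<and>
     bounded ((\<lambda>(x, \<xi>). a x \<xi>) ` (D \<times> S2)) \<and>
     compactly_inside D {x. \<exists>\<xi>\<in>S2. a x \<xi> \<noteq> 0}"

definition source :: "vec3 set \<Rightarrow> (real \<Rightarrow> vec3 \<Rightarrow> vec3 \<Rightarrow> complex) \<Rightarrow> bool" where
  "source D f \<longleftrightarrow>
     C1_on (UNIV \<times> D \<times> S2) (\<lambda>(t, x, \<xi>). f t x \<xi>) \<and>
     bounded ((\<lambda>(t, x, \<xi>). f t x \<xi>) ` (UNIV \<times> D \<times> S2)) \<and>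
     compactly_inside D {x. \<exists>t. \<exists>\<xi>\<in>S2. f t x \<xi> \<noteq> 0}"

text \<open>
  The component of a tensor field with multi-index \<open>i\<^sub>1 \<dots> i\<^sub>m\<close> at \<open>(t, x)\<close> is
  \<open>w t x [i\<^sub>1, \<dots>, i\<^sub>m]\<close>, with indices in the three-element type \<open>3\<close>. Components may be complex.
\<close>

definition symmetric_tensor_field ::
    "vec3 set \<Rightarrow> nat \<Rightarrow> (real \<Rightarrow> vec3 \<Rightarrow> 3 list \<Rightarrow> complex) \<Rightarrow> bool" where
  "symmetric_tensor_field D m w \<longleftrightarrow>
     (\<forall>t x is js. length is = m \<and> mset is = mset js \<longrightarrow> w t x is = w t x js) \<and>
     (\<forall>is. length is = m \<longrightarrow>
        C1_on (UNIV \<times> D) (\<lambda>(t, x). w t x is) \<and>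
        bounded ((\<lambda>(t, x). w t x is) ` (UNIV \<times> D))) \<and>
     compactly_inside D {x. \<exists>t is. length is = m \<and> w t x is \<noteq> 0}"

definition tensor_form ::
    "nat \<Rightarrow> (real \<Rightarrow> vec3 \<Rightarrow> 3 list \<Rightarrow> complex) \<Rightarrow> real \<Rightarrow> vec3 \<Rightarrow> vec3 \<Rightarrow> complex" where
  "tensor_form m w t x \<xi> =
     (\<Sum>is | length is = m. w t x is * of_real (\<Prod>i\<leftarrow>is. \<xi> $ i))"

section \<open>The transform and the transport operator\<close>

definition attenuation ::
    "(vec3 \<Rightarrow> vec3 \<Rightarrow> real) \<Rightarrow> (vec3 \<Rightarrow> vec3 \<Rightarrow> real) \<Rightarrow> vec3 \<Rightarrow> vec3 \<Rightarrow> complex" where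
  "attenuation \<epsilon> \<rho> x \<xi> = of_real (\<epsilon> x \<xi>) + \<i> * of_real (\<rho> x \<xi>)"

definition ART ::
    "(vec3 \<Rightarrow> vec3 \<Rightarrow> complex) \<Rightarrow> nat \<Rightarrow> (real \<Rightarrow> vec3 \<Rightarrow> vec3 \<Rightarrow> complex)
      \<Rightarrow> real \<Rightarrow> vec3 \<Rightarrow> vec3 \<Rightarrow> complex" where
  "ART \<alpha> k f t x \<xi> =
     integral {0..} (\<lambda>s. of_real s ^ k
       * exp (- integral {0..s} (\<lambda>\<sigma>. \<alpha> (x - \<sigma> *\<^sub>R \<xi>) \<xi>))
       * f (t - s) (x - s *\<^sub>R \<xi>) \<xi>)"

definition time_deriv ::
    "(real \<Rightarrow> vec3 \<Rightarrow> vec3 \<Rightarrow> complex) \<Rightarrow> real \<Rightarrow> vec3 \<Rightarrow> vec3 \<Rightarrow> complex" where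
  "time_deriv \<psi> t x \<xi> = vector_derivative (\<lambda>s. \<psi> s x \<xi>) (at t)"

definition ray_deriv ::
    "(real \<Rightarrow> vec3 \<Rightarrow> vec3 \<Rightarrow> complex) \<Rightarrow> real \<Rightarrow> vec3 \<Rightarrow> vec3 \<Rightarrow> complex" where
  "ray_deriv \<psi> t x \<xi> = vector_derivative (\<lambda>\<tau>. \<psi> t (x + \<tau> *\<^sub>R \<xi>) \<xi>) (at 0)"

text \<open>
  The derivatives of a non-differentiable function are arbitrary values, so existence of the
  derivatives is stated as part of the equation. Differentiability in \<open>x\<close> gives all
  partial derivatives \<open>\<partial>\<psi>/\<partial>x\<^sup>j\<close> and, by the lemma below, the coordinate formula for
  the derivative along the ray.
\<close>

definition transport_equation ::
    "vec3 set \<Rightarrow> (vec3 \<Rightarrow> vec3 \<Rightarrow> complex) \<Rightarrow> (real \<Rightarrow> vec3 \<Rightarrow> vec3 \<Rightarrow> complex)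
      \<Rightarrow> (real \<Rightarrow> vec3 \<Rightarrow> vec3 \<Rightarrow> complex) \<Rightarrow> bool" where
  "transport_equation D \<alpha> \<psi> g \<longleftrightarrow>
     (\<forall>t. \<forall>x\<in>D. \<forall>\<xi>\<in>S2.
        (\<lambda>s. \<psi> s x \<xi>) differentiable (at t) \<and>
        (\<lambda>y. \<psi> t y \<xi>) differentiable (at x) \<and>
        time_deriv \<psi> t x \<xi> + ray_deriv \<psi> t x \<xi> + \<alpha> x \<xi> * \<psi> t x \<xi> = g t x \<xi>)"

lemma ray_deriv_eq_sum:
  assumes "(\<lambda>y. \<psi> t y \<xi>) differentiable (at x)"
  shows "ray_deriv \<psi> t x \<xi> =
    (\<Sum>j\<in>UNIV. of_real (\<xi> $ j) * vector_derivative (\<lambda>\<tau>. \<psi> t (x + \<tau> *\<^sub>R axis j 1) \<xi>) (at 0))"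
proof -
  obtain F where F: "((\<lambda>y. \<psi> t y \<xi>) has_derivative F) (at x)"
    using assms by (auto simp: differentiable_def)
  interpret F: linear F
    using F has_derivative_linear by blast
  have dir: "vector_derivative (\<lambda>\<tau>. \<psi> t (x + \<tau> *\<^sub>R v) \<xi>) (at 0) = F v" for v
  proof (rule vector_derivative_at)
    have "((\<lambda>\<tau>. x + \<tau> *\<^sub>R v) has_derivative (\<lambda>h. h *\<^sub>R v)) (at 0)"
      by (auto intro!: derivative_eq_intros)
    from has_derivative_compose[OF this, of "\<lambda>y. \<psi> t y \<xi>" F] F
    show "((\<lambda>\<tau>. \<psi> t (x + \<tau> *\<^sub>R v) \<xi>) has_vector_derivative F v) (at 0)"
      by (simp add: has_vector_derivative_def F.scale)
  qed
  have "F \<xi> = F (\<Sum>j\<in>UNIV. \<xi> $ j *\<^sub>R axis j 1)"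
    using basis_expansion[of \<xi>] by (simp add: scalar_mult_eq_scaleR)
  also have "\<dots> = (\<Sum>j\<in>UNIV. of_real (\<xi> $ j) * F (axis j 1))"
    by (simp only: F.sum F.scale scaleR_conv_of_real[where 'a = complex])
  finally show ?thesis
    unfolding ray_deriv_def dir .
qed

end

theory Submission
  imports Defs
begin

text \<open>
  The equation only couples points on lines with a common direction \<open>\<xi>\<close>, so \<open>\<xi>\<close> can be fixed.
  For fixed \<open>\<xi>\<close> the attenuation and the source, which vanish unless \<open>x\<close> lies in a compact
  subset of \<open>D\<close>, are C1 for all \<open>x\<close> in the whole space (\<open>Ck1_extension_by_zero\<close>). Near a given point all rays leave
  the support within a common length \<open>M\<close>, so there \<open>u\<^sub>k\<close> is the integral over \<open>0 \<le> s \<le> M\<close> of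
  \<open>G\<^sub>k(t, x, s) = s\<^sup>k exp(-A(x, s)) f(t - s, x - s \<xi>)\<close>, where \<open>A\<close> is the integral of \<open>\<alpha>\<close> over the
  segment from \<open>x\<close> back to \<open>x - s \<xi>\<close>. Rescaling that segment to the unit interval shows that
  \<open>A\<close>, and hence \<open>G\<^sub>k\<close>, is C1 in all variables together; differentiation under the integral sign
  then gives the existence of the derivatives of \<open>u\<^sub>k\<close>.

  For the equation itself, write the direction \<open>(1, \<xi>, 0)\<close> of \<open>\<partial>\<^sub>t + H\<close> as \<open>(1, \<xi>, 1) - (0, 0, 1)\<close>.
  Along \<open>(1, \<xi>, 1)\<close> the source point \<open>(t - s, x - s \<xi>)\<close> and the far end of the attenuation
  segment stand still, so only \<open>s\<^sup>k\<close> and the near end of the segment vary, and the derivative of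
  \<open>G\<^sub>k\<close> is \<open>k G\<^bsub>k-1\<^esub> - \<alpha> G\<^sub>k\<close> (\<open>ray_integrand_characteristic_derivative\<close>). The derivative in
  \<open>s\<close> integrates to \<open>G\<^sub>k(t, x, M) - G\<^sub>k(t, x, 0)\<close>, in which the first term vanishes and the second is
  \<open>0\<^sup>k f(t, x)\<close>. Thus \<open>(\<partial>\<^sub>t + H + \<alpha>) u\<^sub>k = k u\<^bsub>k-1\<^esub> + 0\<^sup>k f\<close>, which covers \<open>k = 0\<close> and \<open>k \<ge> 1\<close>
  at once (\<open>ART_transport\<close>).
\<close>

section \<open>Continuously differentiable functions\<close>

lemma Ck1_I:
  assumes der: "\<And>x. x \<in> U \<Longrightarrow> (f has_derivative f' x) (at x)"
    and cont: "\<And>v. continuous_on U (\<lambda>x. f' x v)"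
  shows "Ck_on 1 U f"
proof -
  have "frechet_derivative f (at x) v = f' x v" if "x \<in> U" for x v
    using frechet_derivative_at[OF der[OF that]] by simp
  then have "continuous_on U (\<lambda>x. frechet_derivative f (at x) v)" for v
    using cont[of v] by (simp cong: continuous_on_cong)
  then show ?thesis
    using der by (auto simp: differentiable_def)
qed

lemma Ck1_frechet:
  assumes "Ck_on 1 U f" "x \<in> U"
  shows "(f has_derivative frechet_derivative f (at x)) (at x)"
  using assms by (simp add: frechet_derivative_works)

text \<open>
  In finite dimensions, continuity of each directional derivative is continuity of the
  derivative in the operator norm, which is what composition and differentiation
  under the integral sign consume.
\<close>

lemma Ck1_E:
  fixes f :: "'a::euclidean_space \<Rightarrow> 'b::real_normed_vector"
  assumes "Ck_on 1 U f"
  obtains f' :: "'a \<Rightarrow> 'a \<Rightarrow>\<^sub>L 'b"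
  where "\<And>x. x \<in> U \<Longrightarrow> (f has_derivative blinfun_apply (f' x)) (at x)"
    and "continuous_on U f'"
proof
  let ?f' = "\<lambda>x. Blinfun (frechet_derivative f (at x))"
  have app: "blinfun_apply (?f' x) = frechet_derivative f (at x)" if "x \<in> U" for x
    using Ck1_frechet[OF assms that] by (simp add: bounded_linear_Blinfun_apply has_derivative_bounded_linear)
  show "(f has_derivative blinfun_apply (?f' x)) (at x)" if "x \<in> U" for x
    using Ck1_frechet[OF assms that] app[OF that] by simp
  have "continuous_on U (\<lambda>x. ?f' x i)" for i
  proof -
    have "continuous_on U (\<lambda>x. frechet_derivative f (at x) i)"
      using assms by simp
    then show ?thesis
      using app by (simp cong: continuous_on_cong)
  qed
  then show "continuous_on U ?f'"
    by (auto simp: continuous_on_eq_continuous_within intro!: continuous_blinfun_componentwiseI1)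
qed

lemma Ck1_continuous_on: "Ck_on 1 U f \<Longrightarrow> continuous_on U f"
  by (metis Ck1_frechet continuous_at_imp_continuous_on has_derivative_continuous)

lemma Ck1_subset: "Ck_on 1 U f \<Longrightarrow> V \<subseteq> U \<Longrightarrow> Ck_on 1 V f"
  by (auto intro: continuous_on_subset)

lemma Ck1_cong_open:
  assumes "Ck_on 1 U g" "open U" "\<And>x. x \<in> U \<Longrightarrow> f x = g x"
  shows "Ck_on 1 U f"
proof (rule Ck1_I)
  show "(f has_derivative frechet_derivative g (at x)) (at x)" if "x \<in> U" for x
    by (rule has_derivative_transform_within_open[OF Ck1_frechet[OF assms(1) that] assms(2) that])
      (simp add: assms(3))
  show "continuous_on U (\<lambda>x. frechet_derivative g (at x) v)" for v
    using assms(1) by simp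
qed

lemma Ck1_local:
  assumes "\<And>x. \<exists>V. open V \<and> x \<in> V \<and> Ck_on 1 V f"
  shows "Ck_on 1 UNIV f"
proof (rule Ck1_I)
  show "(f has_derivative frechet_derivative f (at x)) (at x)" for x
    using assms[of x] Ck1_frechet by blast
  show "continuous_on UNIV (\<lambda>x. frechet_derivative f (at x) v)" for v
  proof -
    have "isCont (\<lambda>x. frechet_derivative f (at x) v) x" for x
    proof -
      obtain V where V: "open V" "x \<in> V" "Ck_on 1 V f"
        using assms by blast
      then have "continuous_on V (\<lambda>x. frechet_derivative f (at x) v)"
        by simp
      then show ?thesis
        using V continuous_on_eq_continuous_at by blast
    qed
    then show ?thesis
      by (simp add: continuous_at_imp_continuous_on)
  qed
qed

lemma Ck1_bounded_linear: "bounded_linear h \<Longrightarrow> Ck_on 1 U h"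
  by (rule Ck1_I[where f' = "\<lambda>_. h"]) (auto intro: bounded_linear_imp_has_derivative)

lemma Ck1_const: "Ck_on 1 U (\<lambda>x. c)"
  by (rule Ck1_I[where f' = "\<lambda>_ _. 0"]) auto

lemma Ck1_Pair:
  assumes "Ck_on 1 U f" "Ck_on 1 U g"
  shows "Ck_on 1 U (\<lambda>x. (f x, g x))"
  by (rule Ck1_I[where f' = "\<lambda>x v. (frechet_derivative f (at x) v, frechet_derivative g (at x) v)"])
    (use assms in \<open>auto intro!: has_derivative_Pair continuous_on_Pair Ck1_frechet 
      simp flip: frechet_derivative_works\<close>)

lemma Ck1_compose:
  assumes f: "Ck_on 1 V f" and g: "Ck_on 1 U g" and gU: "\<And>x. x \<in> U \<Longrightarrow> g x \<in> V"
  shows "Ck_on 1 U (\<lambda>x. f (g x))"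
proof -
  from f obtain f' where f': "\<And>x. x \<in> V \<Longrightarrow> (f has_derivative blinfun_apply (f' x)) (at x)"
    and cf': "continuous_on V f'"
    by (rule Ck1_E) blast
  from g obtain g' where g': "\<And>x. x \<in> U \<Longrightarrow> (g has_derivative blinfun_apply (g' x)) (at x)"
    and cg': "continuous_on U g'"
    by (rule Ck1_E) blast
  show ?thesis
  proof (rule Ck1_I)
    show "((\<lambda>x. f (g x)) has_derivative (\<lambda>v. f' (g x) (g' x v))) (at x)" if "x \<in> U" for x
      using has_derivative_compose[OF g'[OF that] f'[OF gU[OF that]]] .
    have "continuous_on U (\<lambda>x. f' (g x))"
      by (rule continuous_on_compose2[OF cf' Ck1_continuous_on[OF g]]) (use gU in auto)
    then show "continuous_on U (\<lambda>x. f' (g x) (g' x v))" for v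
      by (intro continuous_intros cg')
  qed
qed

lemma Ck1_bilinear:
  fixes f :: "'a::euclidean_space \<Rightarrow> 'b::real_normed_vector" and g :: "'a \<Rightarrow> 'c::real_normed_vector"
  assumes "bounded_bilinear p" "Ck_on 1 U f" "Ck_on 1 U g"
  shows "Ck_on 1 U (\<lambda>x. p (f x) (g x))"
proof (rule Ck1_I)
  let ?f' = "\<lambda>x. frechet_derivative f (at x)" and ?g' = "\<lambda>x. frechet_derivative g (at x)"
  show "((\<lambda>x. p (f x) (g x)) has_derivative (\<lambda>v. p (f x) (?g' x v) + p (?f' x v) (g x))) (at x)"
    if "x \<in> U" for x
    by (rule bounded_bilinear.FDERIV[OF assms(1)]) (intro Ck1_frechet[where U = U] assms that)+
  show "continuous_on U (\<lambda>x. p (f x) (?g' x v) + p (?f' x v) (g x))" for v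
    using assms(2,3) Ck1_continuous_on[OF assms(2)] Ck1_continuous_on[OF assms(3)]
    by (intro continuous_on_add bounded_bilinear.continuous_on[OF assms(1)]) auto
qed

lemmas Ck1_mult = Ck1_bilinear[OF bounded_bilinear_mult]
lemmas Ck1_scaleR = Ck1_bilinear[OF bounded_bilinear_scaleR]

lemma Ck1_linear_compose:
  assumes "bounded_linear h" "Ck_on 1 U f"
  shows "Ck_on 1 U (\<lambda>x. h (f x))"
proof (rule Ck1_I)
  show "((\<lambda>x. h (f x)) has_derivative (\<lambda>v. h (frechet_derivative f (at x) v))) (at x)"
    if "x \<in> U" for x
    by (rule bounded_linear.has_derivative[OF assms(1)]) (intro Ck1_frechet[where U = U] assms that)
  show "continuous_on U (\<lambda>x. h (frechet_derivative f (at x) v))" for v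
    using assms by (intro bounded_linear.continuous_on[OF assms(1)]) auto
qed

lemma Ck1_add:
  assumes "Ck_on 1 U f" "Ck_on 1 U g"
  shows "Ck_on 1 U (\<lambda>x. f x + g x)"
proof (rule Ck1_I)
  show "((\<lambda>x. f x + g x) has_derivative
      (\<lambda>v. frechet_derivative f (at x) v + frechet_derivative g (at x) v)) (at x)"
    if "x \<in> U" for x
    by (intro has_derivative_add Ck1_frechet[where U = U] assms that)
  show "continuous_on U (\<lambda>x. frechet_derivative f (at x) v + frechet_derivative g (at x) v)" for v
    using assms by (intro continuous_on_add) auto
qed

lemma Ck1_diff:
  assumes "Ck_on 1 U f" "Ck_on 1 U g"
  shows "Ck_on 1 U (\<lambda>x. f x - g x)"
  using Ck1_add[OF assms(1) Ck1_linear_compose[OF bounded_linear_minus[OF bounded_linear_ident] assms(2)]]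
  by simp

lemma Ck1_sum:
  assumes "\<And>i. i \<in> I \<Longrightarrow> Ck_on 1 U (f i)"
  shows "Ck_on 1 U (\<lambda>x. \<Sum>i\<in>I. f i x)"
  using assms
proof (induction I rule: infinite_finite_induct)
  case (insert i I)
  then have "Ck_on 1 U (\<lambda>x. f i x + (\<Sum>j\<in>I. f j x))"
    by (intro Ck1_add) auto
  then show ?case
    using insert.hyps by simp
qed (auto simp: Ck1_const simp del: One_nat_def Ck_on.simps)

lemma Ck1_power:
  fixes f :: "'a::euclidean_space \<Rightarrow> 'b::real_normed_algebra_1"
  assumes "Ck_on 1 U f"
  shows "Ck_on 1 U (\<lambda>x. f x ^ n)"
proof (induction n)
  case (Suc n)
  then show ?case
    unfolding power_Suc by (rule Ck1_mult[OF assms])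
qed (simp only: power_0 Ck1_const)

lemma Ck1_exp:
  fixes f :: "'a::euclidean_space \<Rightarrow> complex"
  assumes "Ck_on 1 U f"
  shows "Ck_on 1 U (\<lambda>x. exp (f x))"
proof (rule Ck1_compose[OF _ assms])
  show "Ck_on 1 UNIV (exp :: complex \<Rightarrow> complex)"
  proof (rule Ck1_I)
    show "(exp has_derivative (\<lambda>v. exp z * v)) (at z)" for z :: complex
      using DERIV_exp[of z] by (simp add: has_field_derivative_def)
  qed (intro continuous_intros)
qed simp

lemma Ck1_ident: "Ck_on 1 U (\<lambda>x. x)"
  by (rule Ck1_bounded_linear[OF bounded_linear_ident])

lemmas Ck1_intros =
  Ck1_const Ck1_ident Ck1_Pair Ck1_add Ck1_diff Ck1_mult Ck1_scaleR Ck1_power Ck1_exp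
  Ck1_linear_compose[OF bounded_linear_fst] Ck1_linear_compose[OF bounded_linear_snd]
  Ck1_linear_compose[OF bounded_linear_of_real]
  Ck1_linear_compose[OF bounded_linear_minus[OF bounded_linear_ident]]

text \<open>
  Joint continuity of the derivative on the compact range of \<open>s\<close> lets the derivative pass under
  the integral sign. The bounded linear map \<open>h \<mapsto> (h, 0)\<close> turns the full derivative of \<open>g\<close> into
  the partial one.
\<close>

lemma parameter_integral_C1:
  fixes g :: "'a::euclidean_space \<times> real \<Rightarrow> 'b::euclidean_space" and c d :: real
  assumes g: "Ck_on 1 UNIV g"
  defines "I \<equiv> \<lambda>x. integral {c..d} (\<lambda>s. g (x, s))"
  shows has_derivative_parameter_integral:
      "(I has_derivative
         (\<lambda>h. integral {c..d} (\<lambda>s. frechet_derivative g (at (x, s)) (h, 0)))) (at x)"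
    and Ck1_parameter_integral: "Ck_on 1 UNIV I"
proof -
  from g obtain g' where g': "\<And>z. (g has_derivative blinfun_apply (g' z)) (at z)"
    and cg': "continuous_on UNIV g'"
    by (rule Ck1_E) auto
  let ?inj = "Blinfun (\<lambda>h::'a. (h, 0::real))"
  have inj: "blinfun_apply ?inj = (\<lambda>h. (h, 0))"
    by (intro bounded_linear_Blinfun_apply bounded_linear_Pair bounded_linear_ident bounded_linear_zero)
  have fr: "frechet_derivative g (at z) = blinfun_apply (g' z)" for z
    using frechet_derivative_at[OF g'] by simp
  define p where "p x s = g' (x, s) o\<^sub>L ?inj" for x s
  have cp: "continuous_on S (\<lambda>z. p (fst z) (snd z))" for S
    unfolding p_def by (intro continuous_intros continuous_on_compose2[OF cg']) auto
  have cps: "continuous_on S (p x)" for S x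
    unfolding p_def by (intro continuous_intros continuous_on_compose2[OF cg']) auto
  have lin: "blinfun_apply (integral {c..d} (p x)) h
      = integral {c..d} (\<lambda>s. frechet_derivative g (at (x, s)) (h, 0))" for x h
    using blinfun_apply_integral[OF integrable_continuous_real[OF cps[of "{c..d}" x]], of h]
    by (simp add: p_def inj fr)
  have "(I has_derivative blinfun_apply (integral (cbox c d) (p x))) (at x)" for x
    unfolding I_def cbox_interval[symmetric]
  proof (rule leibniz_rule)
    fix x s
    have "((\<lambda>x. (x, s)) has_derivative blinfun_apply ?inj) (at x)"
      unfolding inj by (intro has_derivative_Pair derivative_intros)
    from has_derivative_compose[OF this g']
    show "((\<lambda>x. g (x, s)) has_derivative blinfun_apply (p x s)) (at x within UNIV)"
      by (simp add: p_def inj blinfun_compose.rep_eq o_def)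
  next
    show "(\<lambda>s. g (x, s)) integrable_on cbox c d" for x
      by (intro integrable_continuous continuous_on_compose2[OF Ck1_continuous_on[OF g]]
          continuous_intros) auto
    show "continuous_on (UNIV \<times> cbox c d) (\<lambda>(x, s). p x s)"
      using cp by (simp add: split_beta)
  qed auto
  then have der: "(I has_derivative blinfun_apply (integral {c..d} (p x))) (at x)" for x
    by simp
  then show "(I has_derivative
       (\<lambda>h. integral {c..d} (\<lambda>s. frechet_derivative g (at (x, s)) (h, 0)))) (at x)"
    by (simp add: lin[symmetric])
  show "Ck_on 1 UNIV I"
  proof (rule Ck1_I[OF der])
    have "continuous_on UNIV (\<lambda>x. integral (cbox c d) (p x))"
      by (rule integral_continuous_on_param) (use cp in \<open>simp add: split_beta\<close>)
    then show "continuous_on UNIV (\<lambda>x. integral {c..d} (p x) v)" for v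
      by (intro continuous_intros) simp
  qed
qed

text \<open>
  Freezing some of the variables is the map \<open>h\<close> below. Vanishing off a closed set inside the
  domain is what makes the extension by zero C1: near each point the function is either a C1
  function on the domain or identically zero.
\<close>

lemma Ck1_extension_by_zero:
  assumes f: "C1_on S f" and h: "Ck_on 1 UNIV h" and op: "open (h -` S)"
    and C: "closed C" "C \<subseteq> h -` S"
    and zero: "\<And>z. z \<notin> C \<Longrightarrow> F z = 0" and F: "\<And>z. h z \<in> S \<Longrightarrow> F z = f (h z)"
  shows "Ck_on 1 UNIV F"
proof (rule Ck1_local)
  fix z
  show "\<exists>V. open V \<and> z \<in> V \<and> Ck_on 1 V F"
  proof (cases "z \<in> C")
    case True
    then have "h z \<in> S"
      using C by auto
    then obtain U g where U: "open U" "h z \<in> U" "Ck_on 1 U g" "\<And>x. x \<in> U \<inter> S \<Longrightarrow> g x = f x"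
      using f unfolding C1_on_def by metis
    let ?V = "h -` U \<inter> h -` S"
    have V: "open ?V"
      using open_vimage[OF U(1) Ck1_continuous_on[OF h]] op by (rule open_Int)
    have "Ck_on 1 ?V (\<lambda>z. g (h z))"
      by (rule Ck1_compose[OF U(3) Ck1_subset[OF h]]) auto
    then have "Ck_on 1 ?V F"
      by (rule Ck1_cong_open) (use V U(4) F in auto)
    then show ?thesis
      using V U(2) \<open>h z \<in> S\<close> by blast
  next
    case False
    have "Ck_on 1 (- C) F"
      by (rule Ck1_cong_open[OF Ck1_const[of _ 0]]) (use C zero in auto)
    then show ?thesis
      using False C by blast
  qed
qed

section \<open>The optical depth along a ray\<close>

text \<open>
  This is the integral of \<open>a\<close> over the segment of length \<open>s\<close> behind \<open>x\<close>, rescaled to the unit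
  interval. The fixed domain of integration makes it C1 jointly in \<open>x\<close> and \<open>s\<close> by
  differentiation under the integral sign.
\<close>

definition optical_depth ::
    "('a::euclidean_space \<Rightarrow> complex) \<Rightarrow> 'a \<Rightarrow> 'a \<times> real \<Rightarrow> complex" where
  "optical_depth a \<xi> z =
     integral {0..1} (\<lambda>\<theta>. snd z *\<^sub>R a (fst z - (snd z * \<theta>) *\<^sub>R \<xi>))"

lemma Ck1_optical_depth:
  assumes "Ck_on 1 UNIV a"
  shows "Ck_on 1 UNIV (optical_depth a \<xi>)"
proof -
  have "Ck_on 1 UNIV
      (\<lambda>p. snd (fst p) *\<^sub>R a (fst (fst p) - (snd (fst p) * snd p) *\<^sub>R \<xi>) :: complex)"
    by (intro Ck1_intros Ck1_compose[OF assms]) auto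
  from Ck1_parameter_integral[OF this, of 0 1] show ?thesis
    unfolding optical_depth_def by simp
qed

text \<open>
  With an antiderivative \<open>B\<close> of \<open>a\<close> along the line, the optical depth is a difference of two values
  of \<open>B\<close> for either sign of \<open>s\<close>. Moving both \<open>\<tau>\<close> and \<open>s\<close> by the same amount keeps
  the far end of the segment in place.
\<close>

lemma optical_depth_along_line:
  assumes "continuous_on UNIV a"
  obtains B where "\<And>r. (B has_vector_derivative a (x + r *\<^sub>R \<xi>)) (at r)"
    and "\<And>\<tau> s. optical_depth a \<xi> (x + \<tau> *\<^sub>R \<xi>, s) = B \<tau> - B (\<tau> - s)"
proof -
  have "continuous_on UNIV (\<lambda>r. a (x + r *\<^sub>R \<xi>))"
    by (intro continuous_on_compose2[OF assms] continuous_intros) auto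
  then have "isCont (\<lambda>r. a (x + r *\<^sub>R \<xi>)) r" for r
    by (simp add: continuous_on_eq_continuous_at)
  then obtain B where B: "\<And>r. (B has_vector_derivative a (x + r *\<^sub>R \<xi>)) (at r)"
    using einterval_antiderivative[of "-\<infinity>" "\<infinity>" "\<lambda>r. a (x + r *\<^sub>R \<xi>)"] by auto
  have "optical_depth a \<xi> (x + \<tau> *\<^sub>R \<xi>, s) = B \<tau> - B (\<tau> - s)" for \<tau> s
  proof -
    have "((\<lambda>\<theta>. - B (\<tau> - s * \<theta>)) has_vector_derivative
        s *\<^sub>R a (x + (\<tau> - s * \<theta>) *\<^sub>R \<xi>)) (at \<theta> within {0..1})" for \<theta>
    proof -
      have "((\<lambda>\<theta>. \<tau> - s * \<theta>) has_vector_derivative - s) (at \<theta>)"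
        by (auto intro!: derivative_eq_intros simp: has_real_derivative_iff_has_vector_derivative[symmetric])
      from has_vector_derivative_minus[OF vector_diff_chain_at[OF this B]]
      show ?thesis
        by (simp add: o_def has_vector_derivative_at_within)
    qed
    from fundamental_theorem_of_calculus[OF _ this]
    have "((\<lambda>\<theta>. s *\<^sub>R a (x + (\<tau> - s * \<theta>) *\<^sub>R \<xi>)) has_integral B \<tau> - B (\<tau> - s)) {0..1}"
      by simp
    from integral_unique[OF this] show ?thesis
      by (simp add: optical_depth_def scaleR_left_diff_distrib add_diff_eq)
  qed
  with B show ?thesis
    using that by blast
qed

lemma optical_depth_eq_integral:
  assumes "continuous_on UNIV a" "0 \<le> s"
  shows "integral {0..s} (\<lambda>\<sigma>. a (x - \<sigma> *\<^sub>R \<xi>)) = optical_depth a \<xi> (x, s)"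
proof -
  obtain B where B: "\<And>r. (B has_vector_derivative a (x + r *\<^sub>R \<xi>)) (at r)"
    and depth: "\<And>\<tau> s. optical_depth a \<xi> (x + \<tau> *\<^sub>R \<xi>, s) = B \<tau> - B (\<tau> - s)"
    by (rule optical_depth_along_line[OF assms(1), of x \<xi>]) blast
  have "((\<lambda>\<sigma>. - B (- \<sigma>)) has_vector_derivative a (x - \<sigma> *\<^sub>R \<xi>)) (at \<sigma> within {0..s})" for \<sigma>
  proof -
    have "(uminus has_vector_derivative - 1) (at \<sigma>)"
      by (auto intro!: derivative_eq_intros simp: has_real_derivative_iff_has_vector_derivative[symmetric])
    from has_vector_derivative_minus[OF vector_diff_chain_at[OF this B]]
    show ?thesis
      by (simp add: o_def has_vector_derivative_at_within)
  qed
  from fundamental_theorem_of_calculus[OF assms(2) this] depth[of 0 s]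
  show ?thesis
    by (simp add: integral_unique)
qed

section \<open>The transport equation on a fixed ray direction\<close>

text \<open>
  The variables are grouped as \<open>((t, x), s)\<close>, which separates the parameters of the integral from the
  variable of integration.
\<close>

definition ray_integrand ::
    "('a::euclidean_space \<Rightarrow> complex) \<Rightarrow> (real \<times> 'a \<Rightarrow> complex) \<Rightarrow> 'a \<Rightarrow> nat
      \<Rightarrow> (real \<times> 'a) \<times> real \<Rightarrow> complex" where
  "ray_integrand a F \<xi> k z =
     of_real (snd z) ^ k * exp (- optical_depth a \<xi> (snd (fst z), snd z))
       * F (fst (fst z) - snd z, snd (fst z) - snd z *\<^sub>R \<xi>)"

lemma Ck1_ray_integrand:
  assumes "Ck_on 1 UNIV a" "Ck_on 1 UNIV F"
  shows "Ck_on 1 UNIV (ray_integrand a F \<xi> k)"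
  unfolding ray_integrand_def
  by (intro Ck1_intros Ck1_compose[OF Ck1_optical_depth[OF assms(1)]] Ck1_compose[OF assms(2)]) auto

lemma ray_integrand_0: "ray_integrand a F \<xi> k ((t, x), 0) = 0 ^ k * F (t, x)"
  by (simp add: ray_integrand_def optical_depth_def)

text \<open>
  Advancing \<open>t\<close>, \<open>x\<close> and \<open>s\<close> together leaves the source point \<open>(t - s, x - s \<xi>)\<close>
  fixed, so only the weight and the near end of the attenuation segment contribute.
\<close>

lemma ray_integrand_characteristic_derivative:
  assumes a: "Ck_on 1 UNIV a" and F: "Ck_on 1 UNIV F"
  shows "frechet_derivative (ray_integrand a F \<xi> k) (at ((t, x), s)) ((1, \<xi>), 1) =
    of_nat k * ray_integrand a F \<xi> (k - 1) ((t, x), s) - a x * ray_integrand a F \<xi> k ((t, x), s)"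
proof -
  let ?G = "ray_integrand a F \<xi> k"
  let ?c = "\<lambda>\<tau>. ((t + \<tau>, x + \<tau> *\<^sub>R \<xi>), s + \<tau>)"
  obtain B where B: "\<And>r. (B has_vector_derivative a (x + r *\<^sub>R \<xi>)) (at r)"
    and depth: "\<And>\<tau> s. optical_depth a \<xi> (x + \<tau> *\<^sub>R \<xi>, s) = B \<tau> - B (\<tau> - s)"
    by (rule optical_depth_along_line[OF Ck1_continuous_on[OF a], of x \<xi>]) blast
  have G: "(?G has_derivative frechet_derivative ?G (at z)) (at z)" for z
    by (rule Ck1_frechet[OF Ck1_ray_integrand[OF a F]]) simp
  have "(?c has_derivative (\<lambda>h. ((h, h *\<^sub>R \<xi>), h))) (at 0)"
    by (auto intro!: derivative_eq_intros)
  from has_derivative_compose[OF this, of ?G "frechet_derivative ?G (at ((t, x), s))"] G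
  have "((\<lambda>\<tau>. ?G (?c \<tau>)) has_derivative
      (\<lambda>h. frechet_derivative ?G (at ((t, x), s)) ((h, h *\<^sub>R \<xi>), h))) (at 0)"
    by simp
  moreover have "(\<lambda>h. frechet_derivative ?G (at ((t, x), s)) ((h, h *\<^sub>R \<xi>), h)) =
      (\<lambda>h. h *\<^sub>R frechet_derivative ?G (at ((t, x), s)) ((1, \<xi>), 1))"
  proof
    fix h
    have "((h, h *\<^sub>R \<xi>), h) = h *\<^sub>R ((1, \<xi>), 1::real)"
      by simp
    then show "frechet_derivative ?G (at ((t, x), s)) ((h, h *\<^sub>R \<xi>), h) =
        h *\<^sub>R frechet_derivative ?G (at ((t, x), s)) ((1, \<xi>), 1)"
      using linear_scale[OF has_derivative_linear[OF G]] by metis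
  qed
  ultimately have 1: "((\<lambda>\<tau>. ?G (?c \<tau>)) has_vector_derivative
      frechet_derivative ?G (at ((t, x), s)) ((1, \<xi>), 1)) (at 0)"
    by (simp add: has_vector_derivative_def)
  define q where "q = F (t - s, x - s *\<^sub>R \<xi>)"
  have along: "?G (?c \<tau>) = of_real ((s + \<tau>) ^ k) * exp (- (B \<tau> - B (- s))) * q" for \<tau>
    by (simp add: ray_integrand_def depth q_def algebra_simps)
  have depth0: "optical_depth a \<xi> (x, s) = B 0 - B (- s)"
    using depth[of 0 s] by simp
  have "((\<lambda>\<tau>. - (B \<tau> - B (- s))) has_vector_derivative - a x) (at 0)"
    using B[of 0] by (auto intro!: derivative_eq_intros)
  from field_vector_diff_chain_at[OF this DERIV_exp]
  have E: "((\<lambda>\<tau>. exp (- (B \<tau> - B (- s)))) has_vector_derivative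
      - a x * exp (- (B 0 - B (- s)))) (at 0)"
    by (simp add: o_def)
  have "((\<lambda>\<tau>. (s + \<tau>) ^ k) has_real_derivative real k * s ^ (k - 1)) (at 0)"
    by (auto intro!: derivative_eq_intros)
  then have "((\<lambda>\<tau>. of_real ((s + \<tau>) ^ k)) has_vector_derivative
      complex_of_real (real k * s ^ (k - 1))) (at 0)"
    by (rule has_vector_derivative_of_real)
  from has_vector_derivative_mult_left[OF has_vector_derivative_mult[OF this E], of q]
  have 2: "((\<lambda>\<tau>. ?G (?c \<tau>)) has_vector_derivative
      of_nat k * ray_integrand a F \<xi> (k - 1) ((t, x), s) - a x * ?G ((t, x), s)) (at 0)"
    by (simp add: along) (simp add: ray_integrand_def depth0 q_def algebra_simps)
  show ?thesis
    by (rule vector_derivative_unique_at[OF 1 2])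
qed

text \<open>
  The direction \<open>((1, \<xi>), 0)\<close> is \<open>((1, \<xi>), 1)\<close> minus the direction of \<open>s\<close> alone, and the
  derivative in \<open>s\<close> integrates to boundary terms.
\<close>

lemma truncated_ray_integral_transport:
  fixes a :: "'a::euclidean_space \<Rightarrow> complex" and \<xi> :: 'a
  assumes a: "Ck_on 1 UNIV a" and F: "Ck_on 1 UNIV F" and "0 \<le> M"
  defines "U \<equiv> \<lambda>(k::nat) z. integral {0..M} (\<lambda>s. ray_integrand a F \<xi> k (z, s))"
  shows "frechet_derivative (U k) (at (t, x)) (1, \<xi>) + a x * U k (t, x) =
    of_nat k * U (k - 1) (t, x) + 0 ^ k * F (t, x) - ray_integrand a F \<xi> k ((t, x), M)"
proof -
  let ?G = "ray_integrand a F \<xi>"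
  let ?D = "\<lambda>s. frechet_derivative (?G k) (at ((t, x), s))"
  have C1: "Ck_on 1 UNIV (?G j)" for j
    by (rule Ck1_ray_integrand[OF a F])
  have G: "(?G k has_derivative frechet_derivative (?G k) (at z)) (at z)" for z
    by (rule Ck1_frechet[OF C1]) simp
  have int: "(\<lambda>s. ?G j ((t, x), s)) integrable_on {0..M}" for j
    by (intro integrable_continuous_real continuous_on_compose2[OF Ck1_continuous_on[OF C1]]
        continuous_intros) auto
  have "frechet_derivative (U k) (at (t, x)) (1, \<xi>) = integral {0..M} (\<lambda>s. ?D s ((1, \<xi>), 0))"
    unfolding U_def
    using frechet_derivative_at[OF has_derivative_parameter_integral[OF C1[of k], where c = 0 and d = M and x = "(t, x)"],
      symmetric]
    by simp
  also have "\<dots> = integral {0..M} (\<lambda>s.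
      (of_nat k * ?G (k - 1) ((t, x), s) - a x * ?G k ((t, x), s)) - ?D s ((0, 0), 1))"
  proof (rule integral_cong)
    fix s
    have "?D s ((1, \<xi>), 0) = ?D s (((1, \<xi>), 1) - ((0, 0), 1))"
      by simp
    also have "\<dots> = ?D s ((1, \<xi>), 1) - ?D s ((0, 0), 1)"
      by (rule linear_diff[OF has_derivative_linear[OF G]])
    finally show "?D s ((1, \<xi>), 0) =
        (of_nat k * ?G (k - 1) ((t, x), s) - a x * ?G k ((t, x), s)) - ?D s ((0, 0), 1)"
      by (simp only: ray_integrand_characteristic_derivative[OF a F])
  qed
  also have "\<dots> = (of_nat k * U (k - 1) (t, x) - a x * U k (t, x))
      - (?G k ((t, x), M) - ?G k ((t, x), 0))"
  proof (rule integral_unique, rule has_integral_diff, rule has_integral_diff)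
    show "((\<lambda>s. of_nat k * ?G (k - 1) ((t, x), s)) has_integral of_nat k * U (k - 1) (t, x)) {0..M}"
      unfolding U_def by (intro has_integral_mult_right integrable_integral int)
    show "((\<lambda>s. a x * ?G k ((t, x), s)) has_integral a x * U k (t, x)) {0..M}"
      unfolding U_def by (intro has_integral_mult_right integrable_integral int)
    have "((\<lambda>s. ?G k ((t, x), s)) has_vector_derivative ?D s ((0, 0), 1)) (at s)" for s
    proof -
      have "((\<lambda>s. ((t, x), s)) has_derivative (\<lambda>h. ((0, 0), h))) (at s)"
        by (auto intro!: derivative_eq_intros simp: zero_prod_def)
      from has_derivative_compose[OF this G]
      have "((\<lambda>s. ?G k ((t, x), s)) has_derivative (\<lambda>h. ?D s ((0, 0), h))) (at s)" .
      moreover have "(\<lambda>h. ?D s ((0, 0), h)) = (\<lambda>h. h *\<^sub>R ?D s ((0, 0), 1))"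
      proof
        show "?D s ((0, 0), h) = h *\<^sub>R ?D s ((0, 0), 1)" for h
          using linear_scale[OF has_derivative_linear[OF G], of "((t, x), s)" h "((0, 0), 1)"] by simp
      qed
      ultimately show ?thesis
        by (simp only: has_vector_derivative_def)
    qed
    from fundamental_theorem_of_calculus[OF \<open>0 \<le> M\<close> has_vector_derivative_at_within[OF this]]
    show "((\<lambda>s. ?D s ((0, 0), 1)) has_integral ?G k ((t, x), M) - ?G k ((t, x), 0)) {0..M}" .
  qed
  finally show ?thesis
    by (simp add: ray_integrand_0)
qed

text \<open>
  A ray from a point of norm at most \<open>r\<close> has left the ball of radius \<open>R\<close> once its length
  exceeds \<open>R + r\<close>, so one truncation serves a whole neighbourhood.
\<close>

lemma ART_eq_truncated_ray_integral:
  assumes \<xi>: "norm \<xi> = 1" and a: "continuous_on UNIV (\<lambda>x. \<alpha> x \<xi>)"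
    and supp: "\<And>t x. f t x \<xi> \<noteq> 0 \<Longrightarrow> norm x \<le> R" and x: "norm x \<le> r"
  shows "ART \<alpha> k f t x \<xi> =
    integral {0..R + r} (\<lambda>s. ray_integrand (\<lambda>x. \<alpha> x \<xi>) (\<lambda>p. f (fst p) (snd p) \<xi>) \<xi> k ((t, x), s))"
proof -
  let ?h = "\<lambda>s. of_real s ^ k * exp (- integral {0..s} (\<lambda>\<sigma>. \<alpha> (x - \<sigma> *\<^sub>R \<xi>) \<xi>))
       * f (t - s) (x - s *\<^sub>R \<xi>) \<xi>"
  let ?g = "\<lambda>s. ray_integrand (\<lambda>x. \<alpha> x \<xi>) (\<lambda>p. f (fst p) (snd p) \<xi>) \<xi> k ((t, x), s)"
  have far: "f (t - s) (x - s *\<^sub>R \<xi>) \<xi> = 0" if "0 \<le> s" "R + r < s" for s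
  proof -
    have "s - norm x \<le> norm (x - s *\<^sub>R \<xi>)"
      using norm_triangle_ineq2[of "s *\<^sub>R \<xi>" x] \<xi> that by (simp add: norm_minus_commute)
    then show ?thesis
      using supp[of "t - s" "x - s *\<^sub>R \<xi>"] x that by fastforce
  qed
  have "?h s = ?g s" if "0 \<le> s" for s
    using optical_depth_eq_integral[OF a that, of x \<xi>] by (simp add: ray_integrand_def)
  then have "integral UNIV (\<lambda>s. if s \<in> {0..} then ?h s else 0) =
      integral UNIV (\<lambda>s. if s \<in> {0..R + r} then ?g s else 0)"
    using far by (intro integral_cong) auto
  then show ?thesis
    unfolding ART_def by (simp only: integral_restrict_UNIV)
qed

text \<open>
  Values \<open>k = 0\<close> and \<open>k \<ge> 1\<close> share one formula: the boundary term at \<open>s = 0\<close> carries the weight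
  \<open>0\<^sup>k\<close>, and for \<open>k = 0\<close> the truncated index \<open>k - 1\<close> is multiplied by zero.
\<close>

lemma ART_transport:
  assumes \<xi>: "norm \<xi> = 1" and a: "Ck_on 1 UNIV (\<lambda>x. \<alpha> x \<xi>)"
    and F: "Ck_on 1 UNIV (\<lambda>p. f (fst p) (snd p) \<xi>)"
    and supp: "\<And>t x. f t x \<xi> \<noteq> 0 \<Longrightarrow> norm x \<le> R"
  shows "(\<lambda>s. ART \<alpha> k f s x \<xi>) differentiable (at t)"
    and "(\<lambda>y. ART \<alpha> k f t y \<xi>) differentiable (at x)"
    and "time_deriv (ART \<alpha> k f) t x \<xi> + ray_deriv (ART \<alpha> k f) t x \<xi> + \<alpha> x \<xi> * ART \<alpha> k f t x \<xi> =
      of_nat k * ART \<alpha> (k - 1) f t x \<xi> + 0 ^ k * f t x \<xi>"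
proof -
  \<comment> \<open>The extra 1 puts a neighbourhood of \<open>x\<close> in the ball of radius \<open>r\<close> and makes the integrand
    vanish at the endpoint \<open>M\<close>; the maximum keeps \<open>M\<close> nonnegative.\<close>
  define r where "r = norm x + 1"
  define R' where "R' = max R 0"
  define M where "M = R' + r"
  let ?G = "ray_integrand (\<lambda>x. \<alpha> x \<xi>) (\<lambda>p. f (fst p) (snd p) \<xi>) \<xi>"
  define U where "U k z = integral {0..M} (\<lambda>s. ?G k (z, s))" for k z
  have supp': "norm y \<le> R'" if "f s y \<xi> \<noteq> 0" for s y
    using supp[OF that] by (simp add: R'_def)
  have ART_U: "ART \<alpha> j f s y \<xi> = U j (s, y)" if "norm y \<le> r" for j s y
    unfolding U_def M_def
    using supp' that by (intro ART_eq_truncated_ray_integral \<xi> Ck1_continuous_on a)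
  have "Ck_on 1 UNIV (U k)"
    unfolding U_def by (intro Ck1_parameter_integral Ck1_ray_integrand a F)
  then have U: "(U k has_derivative frechet_derivative (U k) (at z)) (at z)" for z
    by (rule Ck1_frechet) simp
  let ?D = "frechet_derivative (U k) (at (t, x))"
  have x: "x \<in> ball 0 r" "norm x \<le> r"
    by (auto simp: r_def)

  have "((\<lambda>s. (s, x)) has_derivative (\<lambda>h. (h, 0))) (at t)"
    by (auto intro!: derivative_eq_intros)
  from has_derivative_compose[OF this U]
  have t1: "((\<lambda>s. ART \<alpha> k f s x \<xi>) has_derivative (\<lambda>h. ?D (h, 0))) (at t)"
    using x by (simp add: ART_U)
  then show "(\<lambda>s. ART \<alpha> k f s x \<xi>) differentiable (at t)"
    by (rule differentiableI)

  have "((\<lambda>y. (t, y)) has_derivative (\<lambda>h. (0, h))) (at x)"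
    by (auto intro!: derivative_eq_intros)
  from has_derivative_compose[OF this U]
  have "((\<lambda>y. U k (t, y)) has_derivative (\<lambda>h. ?D (0, h))) (at x)" .
  then have x1: "((\<lambda>y. ART \<alpha> k f t y \<xi>) has_derivative (\<lambda>h. ?D (0, h))) (at x)"
    by (rule has_derivative_transform_within_open[OF _ open_ball x(1)]) (simp add: ART_U)
  then show "(\<lambda>y. ART \<alpha> k f t y \<xi>) differentiable (at x)"
    by (rule differentiableI)

  have "(\<lambda>h. ?D (h, 0)) = (\<lambda>h. h *\<^sub>R ?D (1, 0))"
  proof
    show "?D (h, 0) = h *\<^sub>R ?D (1, 0)" for h
      using linear_scale[OF has_derivative_linear[OF U], of "(t, x)" h "(1, 0)"] by simp
  qed
  with t1 have t2: "time_deriv (ART \<alpha> k f) t x \<xi> = ?D (1, 0)"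
    unfolding time_deriv_def
    by (intro vector_derivative_at) (simp only: has_vector_derivative_def)
  have "((\<lambda>\<tau>. x + \<tau> *\<^sub>R \<xi>) has_derivative (\<lambda>h. h *\<^sub>R \<xi>)) (at 0)"
    by (auto intro!: derivative_eq_intros)
  from has_derivative_compose[OF this, of "\<lambda>y. ART \<alpha> k f t y \<xi>" "\<lambda>h. ?D (0, h)"] x1
  have "((\<lambda>\<tau>. ART \<alpha> k f t (x + \<tau> *\<^sub>R \<xi>) \<xi>) has_derivative (\<lambda>h. ?D (0, h *\<^sub>R \<xi>))) (at 0)"
    by simp
  moreover have "(\<lambda>h. ?D (0, h *\<^sub>R \<xi>)) = (\<lambda>h. h *\<^sub>R ?D (0, \<xi>))"
  proof
    show "?D (0, h *\<^sub>R \<xi>) = h *\<^sub>R ?D (0, \<xi>)" for h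
      using linear_scale[OF has_derivative_linear[OF U], of "(t, x)" h "(0, \<xi>)"] by simp
  qed
  ultimately have x2: "ray_deriv (ART \<alpha> k f) t x \<xi> = ?D (0, \<xi>)"
    unfolding ray_deriv_def
    by (intro vector_derivative_at) (simp only: has_vector_derivative_def)
  have sum: "?D (1, 0) + ?D (0, \<xi>) = ?D (1, \<xi>)"
    using linear_add[OF has_derivative_linear[OF U], of "(t, x)" "(1, 0)" "(0, \<xi>)"] by simp

  have "0 \<le> M"
    by (simp add: M_def r_def R'_def add_nonneg_nonneg)
  moreover have "?G k ((t, x), M) = 0"
  proof -
    have "M - norm x \<le> norm (x - M *\<^sub>R \<xi>)"
      using norm_triangle_ineq2[of "M *\<^sub>R \<xi>" x] \<xi> \<open>0 \<le> M\<close> by (simp add: norm_minus_commute)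
    then have "f (t - M) (x - M *\<^sub>R \<xi>) \<xi> = 0"
      using supp'[of "t - M" "x - M *\<^sub>R \<xi>"] by (fastforce simp: M_def r_def)
    then show ?thesis
      by (simp add: ray_integrand_def)
  qed
  ultimately have "?D (1, \<xi>) + \<alpha> x \<xi> * U k (t, x) = of_nat k * U (k - 1) (t, x) + 0 ^ k * f t x \<xi>"
    using truncated_ray_integral_transport[OF a F, of M \<xi> k t x] unfolding U_def by simp
  then show "time_deriv (ART \<alpha> k f) t x \<xi> + ray_deriv (ART \<alpha> k f) t x \<xi>
      + \<alpha> x \<xi> * ART \<alpha> k f t x \<xi> = of_nat k * ART \<alpha> (k - 1) f t x \<xi> + 0 ^ k * f t x \<xi>"
    unfolding t2 x2 sum ART_U[OF x(2)] .
qed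

section \<open>Admissible data on a fixed ray direction\<close>

lemma Ck1_coefficient_slice:
  assumes "open D" "coefficient D a" "\<xi> \<in> S2"
  shows "Ck_on 1 UNIV (\<lambda>x. a x \<xi>)"
proof -
  obtain K where K: "compact K" "K \<subseteq> D" "{x. \<exists>\<xi>\<in>S2. a x \<xi> \<noteq> 0} \<subseteq> K"
    using assms(2) by (auto simp: coefficient_def compactly_inside_def)
  have S: "(\<lambda>x. (x, \<xi>)) -` (D \<times> S2) = D"
    using assms(3) by auto
  show ?thesis
  proof (rule Ck1_extension_by_zero[where h = "\<lambda>x. (x, \<xi>)" and C = K])
    show "C1_on (D \<times> S2) (\<lambda>(x, \<xi>). a x \<xi>)"
      using assms(2) by (simp add: coefficient_def)
    show "Ck_on 1 UNIV (\<lambda>x. (x, \<xi>))"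
      by (intro Ck1_intros)
    show "a x \<xi> = 0" if "x \<notin> K" for x
      using that K(3) assms(3) by blast
  qed (use S K assms in \<open>auto simp: compact_imp_closed\<close>)
qed

lemma Ck1_source_slice:
  assumes "open D" "source D f" "\<xi> \<in> S2"
  shows "Ck_on 1 UNIV (\<lambda>p. f (fst p) (snd p) \<xi>)"
proof -
  obtain K where K: "compact K" "K \<subseteq> D" "{x. \<exists>t. \<exists>\<xi>\<in>S2. f t x \<xi> \<noteq> 0} \<subseteq> K"
    using assms(2) by (auto simp: source_def compactly_inside_def)
  have S: "(\<lambda>p. (fst p, snd p, \<xi>)) -` (UNIV \<times> D \<times> S2) = UNIV \<times> D"
    using assms(3) by auto
  show ?thesis
  proof (rule Ck1_extension_by_zero[where h = "\<lambda>p. (fst p, snd p, \<xi>)" and C = "UNIV \<times> K"])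
    show "C1_on (UNIV \<times> D \<times> S2) (\<lambda>(t, x, \<xi>). f t x \<xi>)"
      using assms(2) by (simp add: source_def)
    show "Ck_on 1 UNIV (\<lambda>p. (fst p, snd p, \<xi>))"
      by (intro Ck1_intros)
    show "f (fst p) (snd p) \<xi> = 0" if "p \<notin> UNIV \<times> K" for p
    proof -
      have "snd p \<notin> K"
        using that by (simp add: mem_Times_iff)
      then show ?thesis
        using K(3) assms(3) by blast
    qed
    show "open ((\<lambda>p. (fst p, snd p, \<xi>)) -` (UNIV \<times> D \<times> S2))"
      unfolding S using assms(1) by (intro open_Times open_UNIV)
  qed (use S K assms in \<open>auto simp: compact_imp_closed closed_Times\<close>)
qed

text \<open>
  For fixed \<open>\<xi>\<close> the form is a finite combination of components with constant coefficients, so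
  regularity in \<open>(t, x)\<close> alone suffices.
\<close>

lemma Ck1_tensor_form:
  assumes "open D" "symmetric_tensor_field D m w"
  shows "Ck_on 1 UNIV (\<lambda>p. tensor_form m w (fst p) (snd p) \<xi>)"
proof -
  obtain K where K: "compact K" "K \<subseteq> D" "{x. \<exists>t is. length is = m \<and> w t x is \<noteq> 0} \<subseteq> K"
    using assms(2) unfolding symmetric_tensor_field_def compactly_inside_def by blast
  have "Ck_on 1 UNIV (\<lambda>p. w (fst p) (snd p) is)" if "length is = m" for "is"
  proof (rule Ck1_extension_by_zero[where h = "\<lambda>p. p" and C = "UNIV \<times> K"])
    show "C1_on (UNIV \<times> D) (\<lambda>(t, x). w t x is)"
      using assms(2) that unfolding symmetric_tensor_field_def by blast
    show "w (fst p) (snd p) is = 0" if "p \<notin> UNIV \<times> K" for p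
    proof -
      have "snd p \<notin> K"
        using that by (simp add: mem_Times_iff)
      then show ?thesis
        using K(3) \<open>length is = m\<close> by blast
    qed
  qed (use K assms(1) in \<open>auto simp: compact_imp_closed closed_Times open_Times Ck1_ident\<close>)
  then show ?thesis
    unfolding tensor_form_def by (intro Ck1_sum Ck1_mult Ck1_const) simp
qed

lemma compactly_inside_norm_bound:
  assumes "compactly_inside D A"
  obtains R where "\<And>x. x \<in> A \<Longrightarrow> norm x \<le> R"
  using assms by (meson bounded_iff bounded_subset compact_imp_bounded compactly_inside_def)

theorem lemma2p5:
  fixes D :: "(real ^ 3) set"
    and \<epsilon> \<rho> :: "real ^ 3 \<Rightarrow> real ^ 3 \<Rightarrow> real"
  assumes "bounded_convex_domain D"
    and "coefficient D \<epsilon>"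
    and "coefficient D \<rho>"
    and "\<forall>x\<in>D. \<forall>\<xi>\<in>S2. \<epsilon> x \<xi> \<ge> 0"
  defines "\<alpha> \<equiv> attenuation \<epsilon> \<rho>"
  shows "(\<forall>f. source D f \<longrightarrow>
            (\<forall>k\<ge>1. transport_equation D \<alpha> (ART \<alpha> k f)
                     (\<lambda>t x \<xi>. of_nat k * ART \<alpha> (k - 1) f t x \<xi>)) \<and>
            transport_equation D \<alpha> (ART \<alpha> 0 f) f) \<and>
         (\<forall>m w. symmetric_tensor_field D m w \<longrightarrow>
            transport_equation D \<alpha> (ART \<alpha> 0 (tensor_form m w)) (tensor_form m w))"
proof -
  have D: "open D"
    using assms(1) by (simp add: bounded_convex_domain_def)
  have \<alpha>: "Ck_on 1 UNIV (\<lambda>x. \<alpha> x \<xi>)" if "\<xi> \<in> S2" for \<xi>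
    unfolding \<alpha>_def attenuation_def
    by (intro Ck1_intros Ck1_coefficient_slice[OF D] that assms(2,3))
  have transport: "transport_equation D \<alpha> (ART \<alpha> k f)
      (\<lambda>t x \<xi>. of_nat k * ART \<alpha> (k - 1) f t x \<xi> + 0 ^ k * f t x \<xi>)"
    if F: "\<And>\<xi>. \<xi> \<in> S2 \<Longrightarrow> Ck_on 1 UNIV (\<lambda>p. f (fst p) (snd p) \<xi>)"
      and R: "\<And>t x \<xi>. \<xi> \<in> S2 \<Longrightarrow> f t x \<xi> \<noteq> 0 \<Longrightarrow> norm x \<le> R"
    for f k R
    unfolding transport_equation_def
  proof (intro allI ballI)
    fix t x \<xi> assume \<xi>: "\<xi> \<in> S2"
    then have "norm \<xi> = 1"
      by simp
    note T = ART_transport[where f = f and \<alpha> = \<alpha>, OF this \<alpha>[OF \<xi>] F[OF \<xi>] R[OF \<xi>],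
        where k = k and x = x and t = t]
    show "(\<lambda>s. ART \<alpha> k f s x \<xi>) differentiable (at t) \<and>
        (\<lambda>y. ART \<alpha> k f t y \<xi>) differentiable (at x) \<and>
        time_deriv (ART \<alpha> k f) t x \<xi> + ray_deriv (ART \<alpha> k f) t x \<xi> + \<alpha> x \<xi> * ART \<alpha> k f t x \<xi> =
          of_nat k * ART \<alpha> (k - 1) f t x \<xi> + 0 ^ k * f t x \<xi>"
      by (intro conjI T)
  qed
  show ?thesis
  proof (intro conjI allI impI)
    fix f assume f: "source D f"
    from f have "compactly_inside D {x. \<exists>t. \<exists>\<xi>\<in>S2. f t x \<xi> \<noteq> 0}"
      by (simp add: source_def)
    then obtain R where "\<And>x. x \<in> {x. \<exists>t. \<exists>\<xi>\<in>S2. f t x \<xi> \<noteq> 0} \<Longrightarrow> norm x \<le> R"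
      by (rule compactly_inside_norm_bound) blast
    then have R: "\<And>t x \<xi>. \<xi> \<in> S2 \<Longrightarrow> f t x \<xi> \<noteq> 0 \<Longrightarrow> norm x \<le> R"
      by blast
    note eq = transport[OF Ck1_source_slice[OF D f] R]
    show "transport_equation D \<alpha> (ART \<alpha> k f) (\<lambda>t x \<xi>. of_nat k * ART \<alpha> (k - 1) f t x \<xi>)"
      if "1 \<le> k" for k
      using eq[where k = k] that by (simp add: power_0_left)
    show "transport_equation D \<alpha> (ART \<alpha> 0 f) f"
      using eq[where k = 0] by simp
  next
    fix m w assume w: "symmetric_tensor_field D m w"
    from w have "compactly_inside D {x. \<exists>t is. length is = m \<and> w t x is \<noteq> 0}"
      unfolding symmetric_tensor_field_def by blast
    then obtain R where "\<And>x. x \<in> {x. \<exists>t is. length is = m \<and> w t x is \<noteq> 0} \<Longrightarrow> norm x \<le> R"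
      by (rule compactly_inside_norm_bound) blast
    then have "norm x \<le> R" if "tensor_form m w t x \<xi> \<noteq> 0" for t x \<xi>
      using that unfolding tensor_form_def by (fastforce elim: sum.not_neutral_contains_not_neutral)
    from transport[OF Ck1_tensor_form[OF D w] this, where k = 0]
    show "transport_equation D \<alpha> (ART \<alpha> 0 (tensor_form m w)) (tensor_form m w)"
      by simp
  qed
qed

end
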